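(* Let $\mathcal L$ be a category with pullbacks and binary products, and let $G:\mathcal E\mathrm{Lens}(\mathcal L)\to\mathrm{Dial}(\mathcal L)$ be the functor sending $\pi_1:A\times X\to A$ to $(A,X,1_{A\times X})$ and an arrow $(f,\ A\times X\xleftarrow{F}A\times Y\xrightarrow{f\times1}B\times Y)$ to $(f,\,F;\pi_2)$. Then the image of $G$ is the full subcategory $\mathcal E\mathrm{Dial}(\mathcal L)$ of $\mathrm{Dial}(\mathcal L)$ whose objects are the triples $(A,X,1_{A\times X})$, and in which an arrow from $(A,X,1_{A\times X})$ to $(B,Y,1_{B\times Y})$ is given by arbitrary arrows $f:A\to B$ and $F:A\times Y\to X$ of $\mathcal L$. Moreover $G:\mathcal E\mathrm{Lens}(\mathcal L)\to\mathcal E\mathrm{Dial}(\mathcal L)$ is an isomorphism of categories, whose inverse $G^{-1}$ sends $(A,X,1_{A\times X})$ to $\pi_1^{A,X}$ and an arrow $(f:A\to B,\ F:A\times Y\to X)$ from $(A,X,1_{A\times X})$ to $(B,Y,1_{B\times Y})$ to $$\big(\,f\,,\ A\times X\xleftarrow{\langle\pi_1,F\rangle}A\times Y\xrightarrow{f\times1}B\times Y\,\big):\pi_1^{A,X}\to\pi_1^{B,Y}.$$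
   Context: Composition is written diagrammatically: $f;g$ is first $f$ then $g$; $\pi_i^{A_1,A_2}:A_1\times A_2\to A_i$ are the projections. **Euclidean lenses.** $\mathcal E\mathrm{Lens}(\mathcal L)$ has as objects the first projections $\pi_1:A\times X\to A$; an arrow from $\pi_1:A\times X\to A$ to $\pi_1:B\times Y\to B$ is an $f:A\to B$ together with a span $A\times X\xleftarrow{F}A\times Y\xrightarrow{f\times1}B\times Y$ such that $F;\pi_1^{A,X}=\pi_1^{A,Y}$. The identity is given by $1_A$ and the identity span. The composite of $(f,F):\pi_1^{A,X}\to\pi_1^{B,Y}$ and $(g,G):\pi_1^{B,Y}\to\pi_1^{C,Z}$ has first component $f;g$ and span $A\times X\xleftarrow{\langle\pi_1,(f\times1);G;\pi_2\rangle;F}A\times Z\xrightarrow{(f;g)\times1}C\times Z$. **Dialectica category.** $\mathrm{Dial}(\mathcal L)$ has as objects triples $(A,X,a)$ with $A,X$ objects of $\mathcal L$ and $a\rightarrowtail A\times X$ a subobject; an arrow from $(A,X,a)$ to $(B,Y,b)$ is a pair $f:A\to B$, $F:A\times Y\to X$ such that the pullback of $a$ along $\langle\pi_1,F\rangle:A\times Y\to A\times X$ factors (necessarily uniquely), as a subobject of $A\times Y$, through the pullback of $b$ along $f\times1:A\times Y\to B\times Y$. The identity on $(A,X,a)$ is $(1_A,\pi_2^{A,X})$ and composition is $(f,F);(g,G)=(f;g,\ \langle\pi_1,(f\times1);G\rangle;F)$. *)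

theory Defs
  imports Main
begin

section \<open>Categories, products, pullbacks\<close>

text \<open>Composition is diagrammatic: \<open>f \<Zcomp> g\<close> is first \<open>f\<close>, then \<open>g\<close>.\<close>

record ('o, 'm) cat =
  Ob :: "'o set"
  Ar :: "'m set"
  Dom :: "'m \<Rightarrow> 'o"
  Cod :: "'m \<Rightarrow> 'o"
  Id :: "'o \<Rightarrow> 'm"
  Comp :: "'m \<Rightarrow> 'm \<Rightarrow> 'm"  (infixl \<open>\<Zcomp>\<index>\<close> 70)

definition Hom :: "('o, 'm, 'z) cat_scheme \<Rightarrow> 'o \<Rightarrow> 'o \<Rightarrow> 'm set" where
  "Hom C A B = {f \<in> Ar C. Dom C f = A \<and> Cod C f = B}"

locale category =
  fixes C :: "('o, 'm, 'z) cat_scheme" (structure)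
  assumes Dom_Ob: "f \<in> Ar C \<Longrightarrow> Dom C f \<in> Ob C"
    and Cod_Ob: "f \<in> Ar C \<Longrightarrow> Cod C f \<in> Ob C"
    and Id_Hom: "A \<in> Ob C \<Longrightarrow> Id C A \<in> Hom C A A"
    and Comp_Hom: "f \<in> Hom C A B \<Longrightarrow> g \<in> Hom C B D \<Longrightarrow> f \<Zcomp> g \<in> Hom C A D"
    and Id_Comp: "f \<in> Hom C A B \<Longrightarrow> Id C A \<Zcomp> f = f"
    and Comp_Id: "f \<in> Hom C A B \<Longrightarrow> f \<Zcomp> Id C B = f"
    and Comp_assoc:
      "f \<in> Hom C A B \<Longrightarrow> g \<in> Hom C B D \<Longrightarrow> h \<in> Hom C D E
        \<Longrightarrow> (f \<Zcomp> g) \<Zcomp> h = f \<Zcomp> (g \<Zcomp> h)"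

text \<open>Projections and pairings refer to chosen products, so a choice of binary
  products is part of the structure.\<close>

record ('o, 'm) prod_cat = "('o, 'm) cat" +
  Prod :: "'o \<Rightarrow> 'o \<Rightarrow> 'o"  (infixr \<open>\<otimes>\<index>\<close> 75)
  pr1 :: "'o \<Rightarrow> 'o \<Rightarrow> 'm"
  pr2 :: "'o \<Rightarrow> 'o \<Rightarrow> 'm"

definition is_product :: "('o, 'm, 'z) cat_scheme \<Rightarrow> 'o \<Rightarrow> 'o \<Rightarrow> 'o \<Rightarrow> 'm \<Rightarrow> 'm \<Rightarrow> bool" where
  "is_product C A B P p q \<longleftrightarrow>
     A \<in> Ob C \<and> B \<in> Ob C \<and> P \<in> Ob C \<and> p \<in> Hom C P A \<and> q \<in> Hom C P B \<and>
     (\<forall>T \<in> Ob C. \<forall>f \<in> Hom C T A. \<forall>g \<in> Hom C T B.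
        \<exists>!h. h \<in> Hom C T P \<and> h \<Zcomp>\<^bsub>C\<^esub> p = f \<and> h \<Zcomp>\<^bsub>C\<^esub> q = g)"

definition has_binary_products :: "('o, 'm, 'z) prod_cat_scheme \<Rightarrow> bool" where
  "has_binary_products L \<longleftrightarrow>
     (\<forall>A \<in> Ob L. \<forall>B \<in> Ob L. is_product L A B (A \<otimes>\<^bsub>L\<^esub> B) (pr1 L A B) (pr2 L A B))"

definition pairing :: "('o, 'm, 'z) prod_cat_scheme \<Rightarrow> 'm \<Rightarrow> 'm \<Rightarrow> 'm"  (\<open>\<langle>_, _\<rangle>\<index>\<close>) where
  "\<langle>f, g\<rangle>\<^bsub>L\<^esub> =
     (THE h. h \<in> Hom L (Dom L f) (Cod L f \<otimes>\<^bsub>L\<^esub> Cod L g) \<and>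
             h \<Zcomp>\<^bsub>L\<^esub> pr1 L (Cod L f) (Cod L g) = f \<and>
             h \<Zcomp>\<^bsub>L\<^esub> pr2 L (Cod L f) (Cod L g) = g)"

definition prod_map :: "('o, 'm, 'z) prod_cat_scheme \<Rightarrow> 'm \<Rightarrow> 'm \<Rightarrow> 'm"  (infixr \<open>\<times>\<index>\<close> 75) where
  "f \<times>\<^bsub>L\<^esub> g = \<langle>pr1 L (Dom L f) (Dom L g) \<Zcomp>\<^bsub>L\<^esub> f, pr2 L (Dom L f) (Dom L g) \<Zcomp>\<^bsub>L\<^esub> g\<rangle>\<^bsub>L\<^esub>"

text \<open>\<open>is_pullback C f g p q\<close>: the square \<open>p \<Zcomp> f = q \<Zcomp> g\<close> is a pullback
  of the cospan \<open>f, g\<close>.\<close>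

definition is_pullback :: "('o, 'm, 'z) cat_scheme \<Rightarrow> 'm \<Rightarrow> 'm \<Rightarrow> 'm \<Rightarrow> 'm \<Rightarrow> bool" where
  "is_pullback C f g p q \<longleftrightarrow>
     {f, g, p, q} \<subseteq> Ar C \<and> Cod C f = Cod C g \<and> Dom C p = Dom C q \<and>
     Cod C p = Dom C f \<and> Cod C q = Dom C g \<and> p \<Zcomp>\<^bsub>C\<^esub> f = q \<Zcomp>\<^bsub>C\<^esub> g \<and>
     (\<forall>T \<in> Ob C. \<forall>u \<in> Hom C T (Dom C f). \<forall>v \<in> Hom C T (Dom C g). u \<Zcomp>\<^bsub>C\<^esub> f = v \<Zcomp>\<^bsub>C\<^esub> g \<longrightarrow>
        (\<exists>!h. h \<in> Hom C T (Dom C p) \<and> h \<Zcomp>\<^bsub>C\<^esub> p = u \<and> h \<Zcomp>\<^bsub>C\<^esub> q = v))"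

definition has_pullbacks :: "('o, 'm, 'z) cat_scheme \<Rightarrow> bool" where
  "has_pullbacks C \<longleftrightarrow>
     (\<forall>f \<in> Ar C. \<forall>g \<in> Ar C. Cod C f = Cod C g \<longrightarrow> (\<exists>p q. is_pullback C f g p q))"

section \<open>Subobjects\<close>

definition is_mono :: "('o, 'm, 'z) cat_scheme \<Rightarrow> 'm \<Rightarrow> bool" where
  "is_mono C m \<longleftrightarrow> m \<in> Ar C \<and>
     (\<forall>T \<in> Ob C. \<forall>u \<in> Hom C T (Dom C m). \<forall>v \<in> Hom C T (Dom C m).
        u \<Zcomp>\<^bsub>C\<^esub> m = v \<Zcomp>\<^bsub>C\<^esub> m \<longrightarrow> u = v)"

definition factors :: "('o, 'm, 'z) cat_scheme \<Rightarrow> 'm \<Rightarrow> 'm \<Rightarrow> bool" where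
  "factors C m n \<longleftrightarrow> (\<exists>k \<in> Hom C (Dom C m) (Dom C n). m = k \<Zcomp>\<^bsub>C\<^esub> n)"

text \<open>A subobject of \<open>A\<close> is an equivalence class of monomorphisms into \<open>A\<close>, two of them
  being identified when each factors through the other.\<close>

definition subobject_of :: "('o, 'm, 'z) cat_scheme \<Rightarrow> 'm \<Rightarrow> 'm set" where
  "subobject_of C m =
     {n. is_mono C n \<and> Cod C n = Cod C m \<and> factors C m n \<and> factors C n m}"

definition Sub :: "('o, 'm, 'z) cat_scheme \<Rightarrow> 'o \<Rightarrow> 'm set set" where
  "Sub C A = {subobject_of C m | m. is_mono C m \<and> Cod C m = A}"

definition sub_le :: "('o, 'm, 'z) cat_scheme \<Rightarrow> 'm set \<Rightarrow> 'm set \<Rightarrow> bool" where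
  "sub_le C s t \<longleftrightarrow> (\<exists>m \<in> s. \<exists>n \<in> t. factors C m n)"

text \<open>The pullback of a subobject \<open>s\<close> along \<open>u\<close> consists of all pullbacks along \<open>u\<close> of all
  representatives of \<open>s\<close>; these form a single equivalence class, so nothing is chosen.\<close>

definition sub_pullback :: "('o, 'm, 'z) cat_scheme \<Rightarrow> 'm \<Rightarrow> 'm set \<Rightarrow> 'm set" where
  "sub_pullback C u s = {n. \<exists>m \<in> s. \<exists>q. is_pullback C u m n q}"

definition sub_top :: "('o, 'm, 'z) cat_scheme \<Rightarrow> 'o \<Rightarrow> 'm set" where
  "sub_top C A = subobject_of C (Id C A)"

section \<open>Functors, images, full subcategories, isomorphisms\<close>

record ('o, 'm, 'p, 'n) cat_map =
  onOb :: "'o \<Rightarrow> 'p"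
  onAr :: "'m \<Rightarrow> 'n"

definition is_functor ::
  "('o, 'm, 'y) cat_scheme \<Rightarrow> ('p, 'n, 'z) cat_scheme \<Rightarrow> ('o, 'm, 'p, 'n) cat_map \<Rightarrow> bool" where
  "is_functor C D F \<longleftrightarrow> category C \<and> category D \<and>
     (\<forall>A \<in> Ob C. onOb F A \<in> Ob D) \<and>
     (\<forall>f \<in> Ar C. onAr F f \<in> Hom D (onOb F (Dom C f)) (onOb F (Cod C f))) \<and>
     (\<forall>A \<in> Ob C. onAr F (Id C A) = Id D (onOb F A)) \<and>
     (\<forall>f \<in> Ar C. \<forall>g \<in> Ar C. Cod C f = Dom C g \<longrightarrow>
        onAr F (f \<Zcomp>\<^bsub>C\<^esub> g) = onAr F f \<Zcomp>\<^bsub>D\<^esub> onAr F g)"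

definition image_cat ::
  "('o, 'm, 'y) cat_scheme \<Rightarrow> ('p, 'n) cat \<Rightarrow> ('o, 'm, 'p, 'n) cat_map \<Rightarrow> ('p, 'n) cat" where
  "image_cat C D F = D\<lparr>Ob := onOb F ` Ob C, Ar := onAr F ` Ar C\<rparr>"

definition full_subcat :: "('o, 'm) cat \<Rightarrow> 'o set \<Rightarrow> ('o, 'm) cat" where
  "full_subcat C S = C\<lparr>Ob := S, Ar := {f \<in> Ar C. Dom C f \<in> S \<and> Cod C f \<in> S}\<rparr>"

definition inverse_functors ::
  "('o, 'm, 'y) cat_scheme \<Rightarrow> ('p, 'n, 'z) cat_scheme \<Rightarrow>
   ('o, 'm, 'p, 'n) cat_map \<Rightarrow> ('p, 'n, 'o, 'm) cat_map \<Rightarrow> bool" where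
  "inverse_functors C D F G \<longleftrightarrow> is_functor C D F \<and> is_functor D C G \<and>
     (\<forall>A \<in> Ob C. onOb G (onOb F A) = A) \<and> (\<forall>f \<in> Ar C. onAr G (onAr F f) = f) \<and>
     (\<forall>B \<in> Ob D. onOb F (onOb G B) = B) \<and> (\<forall>g \<in> Ar D. onAr F (onAr G g) = g)"

definition cat_isomorphism ::
  "('o, 'm, 'y) cat_scheme \<Rightarrow> ('p, 'n, 'z) cat_scheme \<Rightarrow> ('o, 'm, 'p, 'n) cat_map \<Rightarrow> bool" where
  "cat_isomorphism C D F \<longleftrightarrow> (\<exists>G. inverse_functors C D F G)"

section \<open>Euclidean lenses\<close>

text \<open>The object \<open>\<pi>\<^sub>1 : A \<times> X \<rightarrow> A\<close> is encoded as the triple \<open>(A, X, \<pi>\<^sub>1)\<close>: it has to remember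
  \<open>A\<close> and \<open>X\<close>, since the same arrow may be the chosen first projection for several \<open>X\<close>.
  An arrow is \<open>(source, target, f, (F, r))\<close>, where \<open>F\<close> and \<open>r = f \<times> 1\<close> are the left and the
  right leg of the span.\<close>

type_synonym ('o, 'm) lens_ob = "'o \<times> 'o \<times> 'm"
type_synonym ('o, 'm) lens_ar = "('o, 'm) lens_ob \<times> ('o, 'm) lens_ob \<times> 'm \<times> 'm \<times> 'm"

definition ELens :: "('o, 'm, 'z) prod_cat_scheme \<Rightarrow> (('o, 'm) lens_ob, ('o, 'm) lens_ar) cat" where
  "ELens L =
   \<lparr> Ob = {(A, X, pr1 L A X) | A X. A \<in> Ob L \<and> X \<in> Ob L},
     Ar = {((A, X, pr1 L A X), (B, Y, pr1 L B Y), f, (F, f \<times>\<^bsub>L\<^esub> Id L Y)) | A X B Y f F.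
             A \<in> Ob L \<and> X \<in> Ob L \<and> B \<in> Ob L \<and> Y \<in> Ob L \<and>
             f \<in> Hom L A B \<and> F \<in> Hom L (A \<otimes>\<^bsub>L\<^esub> Y) (A \<otimes>\<^bsub>L\<^esub> X) \<and>
             F \<Zcomp>\<^bsub>L\<^esub> pr1 L A X = pr1 L A Y},
     Dom = (\<lambda>(S, T, _). S),
     Cod = (\<lambda>(S, T, _). T),
     Id = (\<lambda>(A, X, p). ((A, X, p), (A, X, p), Id L A, (Id L (A \<otimes>\<^bsub>L\<^esub> X), Id L (A \<otimes>\<^bsub>L\<^esub> X)))),
     Comp = (\<lambda>((A, X, p), (B, Y, q), f, (F, r)) ((B', Y', q'), (C, Z, t), g, (G, s)).
       ((A, X, p), (C, Z, t), f \<Zcomp>\<^bsub>L\<^esub> g,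
        (\<langle>pr1 L A Z, (f \<times>\<^bsub>L\<^esub> Id L Z) \<Zcomp>\<^bsub>L\<^esub> G \<Zcomp>\<^bsub>L\<^esub> pr2 L B Y\<rangle>\<^bsub>L\<^esub> \<Zcomp>\<^bsub>L\<^esub> F,
         (f \<Zcomp>\<^bsub>L\<^esub> g) \<times>\<^bsub>L\<^esub> Id L Z))) \<rparr>"

section \<open>The Dialectica category\<close>

text \<open>An arrow is encoded as \<open>(source, target, f, F)\<close>.\<close>

type_synonym ('o, 'm) dial_ob = "'o \<times> 'o \<times> 'm set"
type_synonym ('o, 'm) dial_ar = "('o, 'm) dial_ob \<times> ('o, 'm) dial_ob \<times> 'm \<times> 'm"

definition Dial :: "('o, 'm, 'z) prod_cat_scheme \<Rightarrow> (('o, 'm) dial_ob, ('o, 'm) dial_ar) cat" where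
  "Dial L =
   \<lparr> Ob = {(A, X, a) | A X a. A \<in> Ob L \<and> X \<in> Ob L \<and> a \<in> Sub L (A \<otimes>\<^bsub>L\<^esub> X)},
     Ar = {((A, X, a), (B, Y, b), f, F) | A X a B Y b f F.
             A \<in> Ob L \<and> X \<in> Ob L \<and> a \<in> Sub L (A \<otimes>\<^bsub>L\<^esub> X) \<and>
             B \<in> Ob L \<and> Y \<in> Ob L \<and> b \<in> Sub L (B \<otimes>\<^bsub>L\<^esub> Y) \<and>
             f \<in> Hom L A B \<and> F \<in> Hom L (A \<otimes>\<^bsub>L\<^esub> Y) X \<and>
             sub_le L (sub_pullback L \<langle>pr1 L A Y, F\<rangle>\<^bsub>L\<^esub> a)
                      (sub_pullback L (f \<times>\<^bsub>L\<^esub> Id L Y) b)},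
     Dom = (\<lambda>(S, T, _). S),
     Cod = (\<lambda>(S, T, _). T),
     Id = (\<lambda>(A, X, a). ((A, X, a), (A, X, a), Id L A, pr2 L A X)),
     Comp = (\<lambda>((A, X, a), (B, Y, b), f, F) ((B', Y', b'), (C, Z, c), g, G).
       ((A, X, a), (C, Z, c), f \<Zcomp>\<^bsub>L\<^esub> g,
        \<langle>pr1 L A Z, (f \<times>\<^bsub>L\<^esub> Id L Z) \<Zcomp>\<^bsub>L\<^esub> G\<rangle>\<^bsub>L\<^esub> \<Zcomp>\<^bsub>L\<^esub> F)) \<rparr>"

definition EDial :: "('o, 'm, 'z) prod_cat_scheme \<Rightarrow> (('o, 'm) dial_ob, ('o, 'm) dial_ar) cat" where
  "EDial L = full_subcat (Dial L)
     {(A, X, sub_top L (A \<otimes>\<^bsub>L\<^esub> X)) | A X. A \<in> Ob L \<and> X \<in> Ob L}"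

section \<open>The comparison functors\<close>

definition lens_to_dial_ob ::
  "('o, 'm, 'z) prod_cat_scheme \<Rightarrow> ('o, 'm) lens_ob \<Rightarrow> ('o, 'm) dial_ob" where
  "lens_to_dial_ob L = (\<lambda>(A, X, p). (A, X, sub_top L (A \<otimes>\<^bsub>L\<^esub> X)))"

definition lens_to_dial :: "('o, 'm, 'z) prod_cat_scheme \<Rightarrow>
    (('o, 'm) lens_ob, ('o, 'm) lens_ar, ('o, 'm) dial_ob, ('o, 'm) dial_ar) cat_map" where
  "lens_to_dial L =
   \<lparr> onOb = lens_to_dial_ob L,
     onAr = (\<lambda>((A, X, p), (B, Y, q), f, (F, r)).
       (lens_to_dial_ob L (A, X, p), lens_to_dial_ob L (B, Y, q), f, F \<Zcomp>\<^bsub>L\<^esub> pr2 L A X)) \<rparr>"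

definition dial_to_lens_ob ::
  "('o, 'm, 'z) prod_cat_scheme \<Rightarrow> ('o, 'm) dial_ob \<Rightarrow> ('o, 'm) lens_ob" where
  "dial_to_lens_ob L = (\<lambda>(A, X, a). (A, X, pr1 L A X))"

definition dial_to_lens :: "('o, 'm, 'z) prod_cat_scheme \<Rightarrow>
    (('o, 'm) dial_ob, ('o, 'm) dial_ar, ('o, 'm) lens_ob, ('o, 'm) lens_ar) cat_map" where
  "dial_to_lens L =
   \<lparr> onOb = dial_to_lens_ob L,
     onAr = (\<lambda>((A, X, a), (B, Y, b), f, F).
       (dial_to_lens_ob L (A, X, a), dial_to_lens_ob L (B, Y, b), f,
        (\<langle>pr1 L A Y, F\<rangle>\<^bsub>L\<^esub>, f \<times>\<^bsub>L\<^esub> Id L Y))) \<rparr>"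

end

theory Submission
  imports Defs
begin

text \<open>Two observations carry the proof. By the universal property of \<open>A \<times> X\<close>, an arrow
  \<open>F : A \<times> Y \<rightarrow> A \<times> X\<close> with \<open>F \<Zcomp> \<pi>\<^sub>1 = \<pi>\<^sub>1\<close> is the same as its second component
  \<open>F \<Zcomp> \<pi>\<^sub>2 : A \<times> Y \<rightarrow> X\<close>, the way back being \<open>F \<mapsto> \<langle>\<pi>\<^sub>1, F\<rangle>\<close>; and the right leg of a
  Euclidean span is determined by \<open>f\<close>. So a lens is an arbitrary pair \<open>(f, F)\<close>. On the other
  side, every arrow into \<open>A \<times> X\<close> factors through the total subobject, so between objects
  \<open>(A, X, 1)\<close> the inclusion demanded of a Dialectica arrow always holds and its arrows are
  arbitrary pairs as well (\<open>Dial_Ar_top_iff\<close>). The two bijections are mutually inverse on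
  objects and arrows, and compatibility with composition is a computation with pairings.

  That both sides are categories has to be shown too. Every equation that arises is decided by
  rewriting: composites are bracketed to the right, pairings are moved outwards, and
  projections are cancelled. The one point beyond such equations is that
  Dialectica arrows compose. For this, subobjects are described by their generalized elements
  (\<open>in_sub\<close>): the inclusion of pullbacks becomes an implication between memberships of
  \<open>t \<Zcomp> \<langle>\<pi>\<^sub>1, F\<rangle>\<close> and \<open>t \<Zcomp> (f \<times> 1)\<close> for all \<open>t\<close> (\<open>sub_le_pullback_iff\<close>), and such implications
  can be chained (\<open>Dial_Comp_Ar\<close>). This is where pullbacks in \<open>L\<close> enter, as the generic
  element of a pulled-back subobject.\<close>

section \<open>Categories and functors\<close>

lemma Hom_iff: "f \<in> Hom C A B \<longleftrightarrow> f \<in> Ar C \<and> Dom C f = A \<and> Cod C f = B"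
  by (simp add: Hom_def)

context category
begin

lemma Id_simps [simp]:
  assumes "A \<in> Ob C"
  shows "Id C A \<in> Ar C" "Dom C (Id C A) = A" "Cod C (Id C A) = A"
  using Id_Hom[OF assms] by (auto simp: Hom_iff)

lemma Comp_simps [simp]:
  assumes "f \<in> Ar C" "g \<in> Ar C" "Cod C f = Dom C g"
  shows "f \<Zcomp> g \<in> Ar C" "Dom C (f \<Zcomp> g) = Dom C f" "Cod C (f \<Zcomp> g) = Cod C g"
  using Comp_Hom[of f "Dom C f" "Dom C g" g "Cod C g"] assms by (auto simp: Hom_iff)

lemma Id_Comp' [simp]: "f \<in> Ar C \<Longrightarrow> Dom C f = A \<Longrightarrow> Id C A \<Zcomp> f = f"
  by (rule Id_Comp) (auto simp: Hom_iff)

lemma Comp_Id' [simp]: "f \<in> Ar C \<Longrightarrow> Cod C f = A \<Longrightarrow> f \<Zcomp> Id C A = f"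
  using Comp_Id[of f "Dom C f" A] by (auto simp: Hom_iff)

lemma Comp_assoc' [simp]:
  "f \<in> Ar C \<Longrightarrow> g \<in> Ar C \<Longrightarrow> h \<in> Ar C \<Longrightarrow> Cod C f = Dom C g \<Longrightarrow> Cod C g = Dom C h
    \<Longrightarrow> (f \<Zcomp> g) \<Zcomp> h = f \<Zcomp> (g \<Zcomp> h)"
  by (rule Comp_assoc) (auto simp: Hom_iff)

lemmas Dom_Cod_Ob [simp] = Dom_Ob Cod_Ob

end

lemma full_subcat_simps [simp]:
  "Ob (full_subcat C S) = S"
  "f \<in> Ar (full_subcat C S) \<longleftrightarrow> f \<in> Ar C \<and> Dom C f \<in> S \<and> Cod C f \<in> S"
  "Dom (full_subcat C S) = Dom C" "Cod (full_subcat C S) = Cod C"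
  "Id (full_subcat C S) = Id C" "Comp (full_subcat C S) = Comp C"
  by (auto simp: full_subcat_def)

lemma Hom_full_subcat:
  "f \<in> Hom (full_subcat C S) A B \<longleftrightarrow> f \<in> Hom C A B \<and> A \<in> S \<and> B \<in> S"
  by (auto simp: Hom_iff)

lemma category_full_subcat:
  assumes "category C" and "S \<subseteq> Ob C"
  shows "category (full_subcat C S)"
proof -
  interpret category C by fact
  show ?thesis
    using assms(2)
    by unfold_locales
      (auto simp: Hom_full_subcat Id_Hom Id_Comp Comp_Id intro: Comp_Hom Comp_assoc)
qed

lemma is_functor_full_subcat:
  assumes F: "is_functor C D F" and S: "S \<subseteq> Ob D" "onOb F ` Ob C \<subseteq> S"
  shows "is_functor C (full_subcat D S) F"
proof -
  interpret C: category C using F by (simp add: is_functor_def)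
  have "category (full_subcat D S)"
    using F S(1) by (intro category_full_subcat) (simp_all add: is_functor_def)
  then show ?thesis
    using F S by (auto simp: is_functor_def Hom_full_subcat image_subset_iff)
qed

text \<open>For an injective functor \<open>F\<close> the equations that \<open>G\<close> has to satisfy can be checked after
  applying \<open>F\<close>. There \<open>F\<close> and \<open>G\<close> cancel and functoriality of \<open>F\<close> remains.\<close>

lemma inverse_functorsI:
  assumes F: "is_functor C D F"
    and G_Ob: "\<And>B. B \<in> Ob D \<Longrightarrow> onOb G B \<in> Ob C"
    and G_Ar: "\<And>g. g \<in> Ar D \<Longrightarrow> onAr G g \<in> Ar C"
    and GF_Ob: "\<And>A. A \<in> Ob C \<Longrightarrow> onOb G (onOb F A) = A"
    and GF_Ar: "\<And>f. f \<in> Ar C \<Longrightarrow> onAr G (onAr F f) = f"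
    and FG_Ob: "\<And>B. B \<in> Ob D \<Longrightarrow> onOb F (onOb G B) = B"
    and FG_Ar: "\<And>g. g \<in> Ar D \<Longrightarrow> onAr F (onAr G g) = g"
  shows "inverse_functors C D F G"
proof -
  interpret C: category C using F by (simp add: is_functor_def)
  interpret D: category D using F by (simp add: is_functor_def)
  have F_Hom: "onAr F f \<in> Hom D (onOb F (Dom C f)) (onOb F (Cod C f))" if "f \<in> Ar C" for f
    using F that by (simp add: is_functor_def)
  have F_Id: "onAr F (Id C A) = Id D (onOb F A)" if "A \<in> Ob C" for A
    using F that by (simp add: is_functor_def)
  have F_Comp: "onAr F (f \<Zcomp>\<^bsub>C\<^esub> g) = onAr F f \<Zcomp>\<^bsub>D\<^esub> onAr F g"
    if "f \<in> Ar C" "g \<in> Ar C" "Cod C f = Dom C g" for f g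
    using F that by (simp add: is_functor_def)
  have G_Dom: "Dom C (onAr G g) = onOb G (Dom D g)"
    and G_Cod: "Cod C (onAr G g) = onOb G (Cod D g)" if "g \<in> Ar D" for g
    using F_Hom[OF G_Ar[OF that]] that
    by (metis C.Dom_Ob C.Cod_Ob FG_Ar G_Ar GF_Ob Hom_iff)+
  have "onAr G (Id D B) = Id C (onOb G B)" if "B \<in> Ob D" for B
    using that by (metis C.Id_simps(1) F_Id FG_Ob G_Ob GF_Ar)
  moreover have "onAr G (f \<Zcomp>\<^bsub>D\<^esub> g) = onAr G f \<Zcomp>\<^bsub>C\<^esub> onAr G g"
    if "f \<in> Ar D" "g \<in> Ar D" "Cod D f = Dom D g" for f g
    using that by (metis C.Comp_simps(1) F_Comp FG_Ar G_Ar GF_Ar G_Cod G_Dom)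
  ultimately have "is_functor D C G"
    using G_Ob G_Ar G_Dom G_Cod
    by (simp add: is_functor_def Hom_iff C.category_axioms D.category_axioms)
  then show ?thesis
    using F GF_Ob GF_Ar FG_Ob FG_Ar by (simp add: inverse_functors_def)
qed

section \<open>Calculus of binary products\<close>

locale product_category = category L
  for L :: "('o, 'm, 'z) prod_cat_scheme" (structure) +
  assumes has_products: "has_binary_products L"
begin

lemma is_product:
  "A \<in> Ob L \<Longrightarrow> B \<in> Ob L \<Longrightarrow> is_product L A B (A \<otimes> B) (pr1 L A B) (pr2 L A B)"
  using has_products by (simp add: has_binary_products_def)

lemma Prod_simps [simp]:
  assumes "A \<in> Ob L" "B \<in> Ob L"
  shows "A \<otimes> B \<in> Ob L"
    "pr1 L A B \<in> Ar L" "Dom L (pr1 L A B) = A \<otimes> B" "Cod L (pr1 L A B) = A"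
    "pr2 L A B \<in> Ar L" "Dom L (pr2 L A B) = A \<otimes> B" "Cod L (pr2 L A B) = B"
  using is_product[OF assms] by (auto simp: is_product_def Hom_iff)

lemma pairing_unique:
  assumes "f \<in> Ar L" "g \<in> Ar L" "Dom L f = Dom L g"
  shows "\<exists>!h. h \<in> Hom L (Dom L f) (Cod L f \<otimes> Cod L g) \<and>
           h \<Zcomp> pr1 L (Cod L f) (Cod L g) = f \<and> h \<Zcomp> pr2 L (Cod L f) (Cod L g) = g"
proof -
  have "is_product L (Cod L f) (Cod L g) (Cod L f \<otimes> Cod L g)
      (pr1 L (Cod L f) (Cod L g)) (pr2 L (Cod L f) (Cod L g))"
    using assms by (intro is_product) simp_all
  then have universal: "\<forall>T \<in> Ob L. \<forall>f' \<in> Hom L T (Cod L f). \<forall>g' \<in> Hom L T (Cod L g).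
      \<exists>!h. h \<in> Hom L T (Cod L f \<otimes> Cod L g) \<and>
        h \<Zcomp> pr1 L (Cod L f) (Cod L g) = f' \<and> h \<Zcomp> pr2 L (Cod L f) (Cod L g) = g'"
    unfolding is_product_def by (elim conjE)
  show ?thesis
    by (rule universal[rule_format]) (use assms in \<open>simp_all add: Hom_iff\<close>)
qed

lemma pairing_simps [simp]:
  assumes "f \<in> Ar L" "g \<in> Ar L" "Dom L f = Dom L g"
  shows "\<langle>f, g\<rangle> \<in> Ar L" "Dom L \<langle>f, g\<rangle> = Dom L g" "Cod L \<langle>f, g\<rangle> = Cod L f \<otimes> Cod L g"
    and "Cod L f = A \<Longrightarrow> Cod L g = B \<Longrightarrow> \<langle>f, g\<rangle> \<Zcomp> pr1 L A B = f"
    and "Cod L f = A \<Longrightarrow> Cod L g = B \<Longrightarrow> \<langle>f, g\<rangle> \<Zcomp> pr2 L A B = g"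
proof -
  have *: "\<langle>f, g\<rangle> \<in> Hom L (Dom L f) (Cod L f \<otimes> Cod L g) \<and>
      \<langle>f, g\<rangle> \<Zcomp> pr1 L (Cod L f) (Cod L g) = f \<and> \<langle>f, g\<rangle> \<Zcomp> pr2 L (Cod L f) (Cod L g) = g"
    using theI'[OF pairing_unique[OF assms]] unfolding pairing_def .
  show "\<langle>f, g\<rangle> \<in> Ar L" "Dom L \<langle>f, g\<rangle> = Dom L g" "Cod L \<langle>f, g\<rangle> = Cod L f \<otimes> Cod L g"
    using * assms(3) by (simp_all add: Hom_iff)
  show "Cod L f = A \<Longrightarrow> Cod L g = B \<Longrightarrow> \<langle>f, g\<rangle> \<Zcomp> pr1 L A B = f"
    and "Cod L f = A \<Longrightarrow> Cod L g = B \<Longrightarrow> \<langle>f, g\<rangle> \<Zcomp> pr2 L A B = g"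
    using * by blast+
qed

lemma pairing_eqI:
  assumes "f \<in> Ar L" "g \<in> Ar L" "Dom L f = Dom L g"
    and "h \<in> Ar L" "Dom L h = Dom L f" "Cod L h = Cod L f \<otimes> Cod L g"
    and "h \<Zcomp> pr1 L (Cod L f) (Cod L g) = f" "h \<Zcomp> pr2 L (Cod L f) (Cod L g) = g"
  shows "\<langle>f, g\<rangle> = h"
  unfolding pairing_def
  by (rule the1_equality[OF pairing_unique[OF assms(1-3)]]) (use assms(4-) in \<open>simp add: Hom_iff\<close>)

text \<open>Once composites are bracketed to the right, a pairing followed by a projection may occur
  in front of a further arrow, where the rule for the bare composite does not match. The same
  applies to \<open>Comp_pairing_Comp\<close> below.\<close>

lemma pairing_pr_Comp [simp]:
  assumes "f \<in> Ar L" "g \<in> Ar L" "Dom L f = Dom L g" "k \<in> Ar L" "Cod L f = A" "Cod L g = B"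
  shows "Dom L k = A \<Longrightarrow> \<langle>f, g\<rangle> \<Zcomp> (pr1 L A B \<Zcomp> k) = f \<Zcomp> k"
    and "Dom L k = B \<Longrightarrow> \<langle>f, g\<rangle> \<Zcomp> (pr2 L A B \<Zcomp> k) = g \<Zcomp> k"
  using assms by (auto simp flip: Comp_assoc')

lemma Comp_pairing [simp]:
  assumes "f \<in> Ar L" "g \<in> Ar L" "Dom L f = Dom L g" "h \<in> Ar L" "Cod L h = Dom L f"
  shows "h \<Zcomp> \<langle>f, g\<rangle> = \<langle>h \<Zcomp> f, h \<Zcomp> g\<rangle>"
  using assms by (intro pairing_eqI[symmetric]) auto

lemma Comp_pairing_Comp [simp]:
  assumes "f \<in> Ar L" "g \<in> Ar L" "Dom L f = Dom L g" "h \<in> Ar L" "Cod L h = Dom L f"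
    "k \<in> Ar L" "Dom L k = Cod L f \<otimes> Cod L g"
  shows "h \<Zcomp> (\<langle>f, g\<rangle> \<Zcomp> k) = \<langle>h \<Zcomp> f, h \<Zcomp> g\<rangle> \<Zcomp> k"
  using assms by (subst Comp_assoc'[symmetric]) (auto simp del: Comp_assoc')

lemma pairing_pr1_pr2 [simp]:
  "A \<in> Ob L \<Longrightarrow> B \<in> Ob L \<Longrightarrow> \<langle>pr1 L A B, pr2 L A B\<rangle> = Id L (A \<otimes> B)"
  by (intro pairing_eqI) auto

lemma pairing_Comp_pr1_pr2:
  "h \<in> Ar L \<Longrightarrow> Cod L h = A \<otimes> B \<Longrightarrow> A \<in> Ob L \<Longrightarrow> B \<in> Ob L
    \<Longrightarrow> \<langle>h \<Zcomp> pr1 L A B, h \<Zcomp> pr2 L A B\<rangle> = h"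
  by (intro pairing_eqI) auto

lemma prod_map_Id:
  "f \<in> Ar L \<Longrightarrow> Y \<in> Ob L \<Longrightarrow> f \<times>\<^bsub>L\<^esub> Id L Y = \<langle>pr1 L (Dom L f) Y \<Zcomp> f, pr2 L (Dom L f) Y\<rangle>"
  by (simp add: prod_map_def)

section \<open>The category of Euclidean lenses\<close>

lemma ELens_simps:
  "Ob (ELens L) = {(A, X, pr1 L A X) | A X. A \<in> Ob L \<and> X \<in> Ob L}"
  "Dom (ELens L) (S, T, u) = S"
  "Cod (ELens L) (S, T, u) = T"
  "Id (ELens L) (A, X, p) = ((A, X, p), (A, X, p), Id L A, (Id L (A \<otimes> X), Id L (A \<otimes> X)))"
  "((A, X, p), (B, Y, q), f, (F, r)) \<Zcomp>\<^bsub>ELens L\<^esub> ((B', Y', q'), (C, Z, t), g, (G, s)) =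
     ((A, X, p), (C, Z, t), f \<Zcomp> g,
      (\<langle>pr1 L A Z, (f \<times>\<^bsub>L\<^esub> Id L Z) \<Zcomp> G \<Zcomp> pr2 L B Y\<rangle> \<Zcomp> F, (f \<Zcomp> g) \<times>\<^bsub>L\<^esub> Id L Z))"
  by (simp_all add: ELens_def)

lemma ELens_Ar_iff:
  "((A, X, p), (B, Y, q), f, (F, r)) \<in> Ar (ELens L) \<longleftrightarrow>
     A \<in> Ob L \<and> X \<in> Ob L \<and> B \<in> Ob L \<and> Y \<in> Ob L \<and> p = pr1 L A X \<and> q = pr1 L B Y \<and>
     f \<in> Ar L \<and> Dom L f = A \<and> Cod L f = B \<and>
     F \<in> Ar L \<and> Dom L F = A \<otimes> Y \<and> Cod L F = A \<otimes> X \<and> F \<Zcomp> pr1 L A X = pr1 L A Y \<and>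
     r = f \<times>\<^bsub>L\<^esub> Id L Y"
  by (auto simp: ELens_def Hom_iff)

lemma ELens_ArE:
  assumes "\<phi> \<in> Ar (ELens L)"
  obtains A X B Y f F where
    "\<phi> = ((A, X, pr1 L A X), (B, Y, pr1 L B Y), f, (F, f \<times>\<^bsub>L\<^esub> Id L Y))"
    "A \<in> Ob L" "X \<in> Ob L" "B \<in> Ob L" "Y \<in> Ob L"
    "f \<in> Hom L A B" "F \<in> Hom L (A \<otimes> Y) (A \<otimes> X)" "F \<Zcomp> pr1 L A X = pr1 L A Y"
proof -
  obtain A X p B Y q f F r where \<phi>: "\<phi> = ((A, X, p), (B, Y, q), f, (F, r))"
    by (metis surj_pair)
  with assms show ?thesis
    by (intro that[of A X B Y f F]) (simp_all add: ELens_Ar_iff Hom_iff)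
qed

lemma ELens_HomE:
  assumes "\<phi> \<in> Hom (ELens L) S T"
  obtains A X B Y f F where
    "S = (A, X, pr1 L A X)" "T = (B, Y, pr1 L B Y)"
    "\<phi> = ((A, X, pr1 L A X), (B, Y, pr1 L B Y), f, (F, f \<times>\<^bsub>L\<^esub> Id L Y))"
    "A \<in> Ob L" "X \<in> Ob L" "B \<in> Ob L" "Y \<in> Ob L"
    "f \<in> Hom L A B" "F \<in> Hom L (A \<otimes> Y) (A \<otimes> X)" "F \<Zcomp> pr1 L A X = pr1 L A Y"
proof -
  have "\<phi> \<in> Ar (ELens L)" "S = Dom (ELens L) \<phi>" "T = Cod (ELens L) \<phi>"
    using assms by (simp_all add: Hom_iff)
  then show ?thesis
    by (elim ELens_ArE) (rule that, simp_all add: ELens_simps)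
qed

lemma category_ELens: "category (ELens L)"
proof
  fix \<phi> assume "\<phi> \<in> Ar (ELens L)"
  then have "\<phi> \<in> Hom (ELens L) (Dom (ELens L) \<phi>) (Cod (ELens L) \<phi>)"
    by (simp add: Hom_iff)
  then show "Dom (ELens L) \<phi> \<in> Ob (ELens L)" "Cod (ELens L) \<phi> \<in> Ob (ELens L)"
    by (elim ELens_HomE, simp add: ELens_simps)+
next
  fix S assume "S \<in> Ob (ELens L)"
  then show "Id (ELens L) S \<in> Hom (ELens L) S S"
    by (auto simp: ELens_simps ELens_Ar_iff Hom_iff prod_map_Id)
next
  fix \<phi> \<psi> S T U
  assume "\<phi> \<in> Hom (ELens L) S T" "\<psi> \<in> Hom (ELens L) T U"
  then show "\<phi> \<Zcomp>\<^bsub>ELens L\<^esub> \<psi> \<in> Hom (ELens L) S U"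
    by (elim ELens_HomE, clarify, simp add: ELens_simps ELens_Ar_iff Hom_iff prod_map_Id)
next
  fix \<phi> S T
  assume "\<phi> \<in> Hom (ELens L) S T"
  \<comment> \<open>A left leg over \<open>A\<close> is determined by its second component, and precomposing with the
    identity lens keeps exactly that component.\<close>
  then show "Id (ELens L) S \<Zcomp>\<^bsub>ELens L\<^esub> \<phi> = \<phi>"
  proof (cases rule: ELens_HomE)
    case (1 A X B Y f F)
    then show ?thesis
      using pairing_Comp_pr1_pr2[of F A X] by (simp add: ELens_simps prod_map_Id Hom_iff)
  qed
  from \<open>\<phi> \<in> Hom (ELens L) S T\<close> show "\<phi> \<Zcomp>\<^bsub>ELens L\<^esub> Id (ELens L) T = \<phi>"
    by (elim ELens_HomE, clarify, simp add: ELens_simps prod_map_Id Hom_iff)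
next
  fix \<phi> \<psi> \<chi> S T U V
  assume "\<phi> \<in> Hom (ELens L) S T" "\<psi> \<in> Hom (ELens L) T U" "\<chi> \<in> Hom (ELens L) U V"
  then show "(\<phi> \<Zcomp>\<^bsub>ELens L\<^esub> \<psi>) \<Zcomp>\<^bsub>ELens L\<^esub> \<chi> = \<phi> \<Zcomp>\<^bsub>ELens L\<^esub> (\<psi> \<Zcomp>\<^bsub>ELens L\<^esub> \<chi>)"
    by (elim ELens_HomE, clarify, simp add: ELens_simps prod_map_Id Hom_iff)
qed

end

section \<open>Generalized elements of subobjects\<close>

text \<open>An arrow into the ambient object is a generalized element of a subobject when it factors
  through one, equivalently every, representative. In these terms the inclusions in the
  Dialectica category can be chained without comparing iterated pullbacks.\<close>

definition in_sub :: "('o, 'm, 'z) cat_scheme \<Rightarrow> 'm \<Rightarrow> 'm set \<Rightarrow> bool" where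
  "in_sub C t s \<longleftrightarrow> (\<exists>m \<in> s. factors C t m)"

context category
begin

lemma factorsI: "k \<in> Ar C \<Longrightarrow> n \<in> Ar C \<Longrightarrow> Cod C k = Dom C n \<Longrightarrow> factors C (k \<Zcomp> n) n"
  unfolding factors_def by (rule bexI[of _ k]) (auto simp: Hom_iff)

lemma factorsE:
  assumes "factors C m n"
  obtains k where "k \<in> Ar C" "Dom C k = Dom C m" "Cod C k = Dom C n" "m = k \<Zcomp> n"
  using assms by (auto simp: factors_def Hom_iff)

lemma factors_refl: "m \<in> Ar C \<Longrightarrow> factors C m m"
  using factorsI[of "Id C (Dom C m)" m] by simp

lemma factors_trans:
  assumes "factors C l m" "factors C m n" "n \<in> Ar C"
  shows "factors C l n"
proof -
  obtain j where j: "j \<in> Ar C" "Cod C j = Dom C m" "l = j \<Zcomp> m"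
    using assms(1) by (rule factorsE)
  obtain k where k: "k \<in> Ar C" "Dom C k = Dom C m" "Cod C k = Dom C n" "m = k \<Zcomp> n"
    using assms(2) by (rule factorsE)
  have "l = (j \<Zcomp> k) \<Zcomp> n"
    unfolding j(3) using assms(3) j(1,2) k(1-3) by (subst k(4)) simp
  moreover have "factors C ((j \<Zcomp> k) \<Zcomp> n) n"
    using assms(3) j(1,2) k(1-3) by (intro factorsI) simp_all
  ultimately show ?thesis by simp
qed

lemma Sub_nonempty:
  assumes "s \<in> Sub C A"
  obtains m where "m \<in> s"
proof -
  obtain m where "s = subobject_of C m" "is_mono C m"
    using assms by (auto simp: Sub_def)
  then have "m \<in> s"
    by (simp add: subobject_of_def is_mono_def factors_refl)
  then show ?thesis by (rule that)
qed

lemma Sub_member: "s \<in> Sub C A \<Longrightarrow> m \<in> s \<Longrightarrow> m \<in> Ar C \<and> Cod C m = A"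
  by (auto simp: Sub_def subobject_of_def is_mono_def)

lemma in_sub_iff_factors:
  assumes "s \<in> Sub C A" "m \<in> s"
  shows "in_sub C t s \<longleftrightarrow> factors C t m"
proof
  assume "in_sub C t s"
  then obtain m' where m': "m' \<in> s" "factors C t m'"
    by (auto simp: in_sub_def)
  obtain m0 where m0: "s = subobject_of C m0" "is_mono C m0"
    using assms(1) by (auto simp: Sub_def)
  have "factors C m' m0" "factors C m0 m" "m0 \<in> Ar C" "m \<in> Ar C"
    using m0 m'(1) assms(2) by (auto simp: subobject_of_def is_mono_def)
  with m'(2) show "factors C t m"
    by (blast intro: factors_trans)
next
  assume "factors C t m"
  with assms(2) show "in_sub C t s" by (auto simp: in_sub_def)
qed

lemma is_mono_Id: "A \<in> Ob C \<Longrightarrow> is_mono C (Id C A)"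
  by (simp add: is_mono_def Hom_iff)

lemma sub_top_Sub: "A \<in> Ob C \<Longrightarrow> sub_top C A \<in> Sub C A"
  unfolding sub_top_def Sub_def using is_mono_Id by force

lemma in_sub_top:
  assumes "t \<in> Ar C" "Cod C t = A"
  shows "in_sub C t (sub_top C A)"
proof -
  have A: "A \<in> Ob C" using assms by auto
  then have "Id C A \<in> sub_top C A"
    by (simp add: sub_top_def subobject_of_def is_mono_Id factors_refl)
  moreover have "factors C t (Id C A)"
    using factorsI[of t "Id C A"] A assms by simp
  ultimately show ?thesis
    by (auto simp: in_sub_def)
qed

lemma is_pullback_lift:
  assumes "is_pullback C f g p q"
    and "u \<in> Ar C" "Cod C u = Dom C f" "v \<in> Ar C" "Cod C v = Dom C g"
    and "Dom C u = Dom C v" "u \<Zcomp> f = v \<Zcomp> g"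
  obtains h where "h \<in> Ar C" "Dom C h = Dom C u" "Cod C h = Dom C p" "h \<Zcomp> p = u" "h \<Zcomp> q = v"
proof -
  have universal: "\<forall>T \<in> Ob C. \<forall>u \<in> Hom C T (Dom C f). \<forall>v \<in> Hom C T (Dom C g). u \<Zcomp> f = v \<Zcomp> g \<longrightarrow>
      (\<exists>!h. h \<in> Hom C T (Dom C p) \<and> h \<Zcomp> p = u \<and> h \<Zcomp> q = v)"
    using assms(1) unfolding is_pullback_def by (elim conjE)
  have "\<exists>!h. h \<in> Hom C (Dom C u) (Dom C p) \<and> h \<Zcomp> p = u \<and> h \<Zcomp> q = v"
    by (rule universal[rule_format]) (use assms(2-) in \<open>simp_all add: Hom_iff\<close>)
  then show ?thesis
    by (elim ex1E conjE) (rule that, simp_all add: Hom_iff)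
qed

text \<open>A pullback of a subobject along \<open>u\<close> has as generalized elements those \<open>t\<close> for which
  \<open>t \<Zcomp> u\<close> is one of the subobject, and inclusion of subobjects is inclusion of generalized
  elements: the representing monomorphism is itself the generic element.\<close>

lemma sub_le_pullback_iff:
  assumes pb: "has_pullbacks C"
    and a: "a \<in> Sub C (Cod C u)" and b: "b \<in> Sub C (Cod C v)"
    and u: "u \<in> Ar C" and v: "v \<in> Ar C" and uv: "Dom C u = Dom C v"
  shows "sub_le C (sub_pullback C u a) (sub_pullback C v b) \<longleftrightarrow>
    (\<forall>t \<in> Ar C. Cod C t = Dom C u \<longrightarrow> in_sub C (t \<Zcomp> u) a \<longrightarrow> in_sub C (t \<Zcomp> v) b)"
    (is "?L \<longleftrightarrow> ?R")
proof
  assume ?L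
  then obtain m n m' n' p q where mn: "m' \<in> a" "is_pullback C u m' m p"
    "n' \<in> b" "is_pullback C v n' n q" "factors C m n"
    unfolding sub_le_def sub_pullback_def by blast
  show ?R
  proof (intro ballI impI)
    fix t assume t: "t \<in> Ar C" "Cod C t = Dom C u" "in_sub C (t \<Zcomp> u) a"
    have m': "m' \<in> Ar C" "Cod C m' = Cod C u" and n': "n' \<in> Ar C" "Cod C n' = Cod C v"
      using Sub_member[OF a] Sub_member[OF b] mn by auto
    have "factors C (t \<Zcomp> u) m'"
      using t(3) by (simp add: in_sub_iff_factors[OF a mn(1)])
    then obtain k where k: "k \<in> Ar C" "Dom C k = Dom C (t \<Zcomp> u)" "Cod C k = Dom C m'"
      "t \<Zcomp> u = k \<Zcomp> m'"
      by (rule factorsE)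
    have k_Dom: "Dom C k = Dom C t"
      using k(2) t(1,2) u by simp
    obtain h where h: "h \<in> Ar C" "Cod C h = Dom C m" "h \<Zcomp> m = t"
      by (rule is_pullback_lift[OF mn(2) t(1,2) k(1,3) k_Dom[symmetric] k(4)])
    obtain l where l: "l \<in> Ar C" "Dom C l = Dom C m" "Cod C l = Dom C n" "m = l \<Zcomp> n"
      using mn(5) by (rule factorsE)
    have q: "n \<in> Ar C" "q \<in> Ar C" "Dom C q = Dom C n" "Cod C q = Dom C n'"
      "Cod C n = Dom C v" "n \<Zcomp> v = q \<Zcomp> n'"
      using mn(4) by (auto simp: is_pullback_def)
    have "t \<Zcomp> v = (h \<Zcomp> (l \<Zcomp> n)) \<Zcomp> v"
      unfolding h(3)[symmetric] l(4)[symmetric] ..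
    also have "\<dots> = (h \<Zcomp> (l \<Zcomp> q)) \<Zcomp> n'"
      using h(1,2) l(1-3) q v n' by simp
    finally have "t \<Zcomp> v = (h \<Zcomp> (l \<Zcomp> q)) \<Zcomp> n'" .
    moreover have "factors C ((h \<Zcomp> (l \<Zcomp> q)) \<Zcomp> n') n'"
      using h(1,2) l(1-3) q n' by (intro factorsI) simp_all
    ultimately show "in_sub C (t \<Zcomp> v) b"
      by (simp add: in_sub_iff_factors[OF b mn(3)])
  qed
next
  assume R: ?R
  obtain m' n' where m': "m' \<in> a" and n': "n' \<in> b"
    using a b by (meson Sub_nonempty)
  have m'_Ar: "m' \<in> Ar C" "Cod C m' = Cod C u" and n'_Ar: "n' \<in> Ar C" "Cod C n' = Cod C v"
    using Sub_member[OF a m'] Sub_member[OF b n'] by auto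
  obtain m p where m: "is_pullback C u m' m p"
    using pb u m'_Ar unfolding has_pullbacks_def by metis
  obtain n q where n: "is_pullback C v n' n q"
    using pb v n'_Ar unfolding has_pullbacks_def by metis
  have mp: "m \<in> Ar C" "Cod C m = Dom C u" "p \<in> Ar C" "Cod C p = Dom C m'" "m \<Zcomp> u = p \<Zcomp> m'"
    using m by (auto simp: is_pullback_def)
  have "in_sub C (m \<Zcomp> u) a"
    unfolding in_sub_iff_factors[OF a m'] mp(5) by (intro factorsI) (use mp m'_Ar in auto)
  then have "in_sub C (m \<Zcomp> v) b"
    using R mp by blast
  then have "factors C (m \<Zcomp> v) n'"
    by (simp add: in_sub_iff_factors[OF b n'])
  then obtain k where k: "k \<in> Ar C" "Dom C k = Dom C (m \<Zcomp> v)" "Cod C k = Dom C n'"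
    "m \<Zcomp> v = k \<Zcomp> n'"
    by (rule factorsE)
  have k_Dom: "Dom C k = Dom C m"
    using k(2) mp(1,2) uv v by simp
  have "Cod C m = Dom C v"
    using mp(2) uv by simp
  then obtain h where h: "h \<in> Ar C" "Dom C h = Dom C m" "Cod C h = Dom C n" "h \<Zcomp> n = m"
    by (rule is_pullback_lift[OF n mp(1) _ k(1,3) k_Dom[symmetric] k(4)])
  have "factors C m n"
    unfolding factors_def
    by (rule bexI[of _ h]) (rule h(4)[symmetric], use h(1-3) in \<open>simp add: Hom_iff\<close>)
  then show ?L
    using m n m' n' unfolding sub_le_def sub_pullback_def by blast
qed

end

section \<open>The Dialectica category\<close>

context product_category
begin

lemma Dial_simps:
  "Ob (Dial L) = {(A, X, a) | A X a. A \<in> Ob L \<and> X \<in> Ob L \<and> a \<in> Sub L (A \<otimes> X)}"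
  "Dom (Dial L) (S, T, u) = S"
  "Cod (Dial L) (S, T, u) = T"
  "Id (Dial L) (A, X, a) = ((A, X, a), (A, X, a), Id L A, pr2 L A X)"
  "((A, X, a), (B, Y, b), f, F) \<Zcomp>\<^bsub>Dial L\<^esub> ((B', Y', b'), (C, Z, c), g, G) =
     ((A, X, a), (C, Z, c), f \<Zcomp> g, \<langle>pr1 L A Z, (f \<times>\<^bsub>L\<^esub> Id L Z) \<Zcomp> G\<rangle> \<Zcomp> F)"
  by (simp_all add: Dial_def)

end

locale product_pullback_category = product_category +
  assumes has_pullbacks: "has_pullbacks L"
begin

lemma Dial_Ar_iff:
  "((A, X, a), (B, Y, b), f, F) \<in> Ar (Dial L) \<longleftrightarrow>
     A \<in> Ob L \<and> X \<in> Ob L \<and> a \<in> Sub L (A \<otimes> X) \<and> B \<in> Ob L \<and> Y \<in> Ob L \<and> b \<in> Sub L (B \<otimes> Y) \<and>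
     f \<in> Ar L \<and> Dom L f = A \<and> Cod L f = B \<and> F \<in> Ar L \<and> Dom L F = A \<otimes> Y \<and> Cod L F = X \<and>
     (\<forall>t \<in> Ar L. Cod L t = A \<otimes> Y \<longrightarrow>
        in_sub L (t \<Zcomp> \<langle>pr1 L A Y, F\<rangle>) a \<longrightarrow> in_sub L (t \<Zcomp> (f \<times>\<^bsub>L\<^esub> Id L Y)) b)"
    (is "_ \<longleftrightarrow> ?R")
proof -
  have "sub_le L (sub_pullback L \<langle>pr1 L A Y, F\<rangle> a) (sub_pullback L (f \<times>\<^bsub>L\<^esub> Id L Y) b) \<longleftrightarrow>
      (\<forall>t \<in> Ar L. Cod L t = A \<otimes> Y \<longrightarrow>
        in_sub L (t \<Zcomp> \<langle>pr1 L A Y, F\<rangle>) a \<longrightarrow> in_sub L (t \<Zcomp> (f \<times>\<^bsub>L\<^esub> Id L Y)) b)"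
    if "A \<in> Ob L" "X \<in> Ob L" "a \<in> Sub L (A \<otimes> X)" "B \<in> Ob L" "Y \<in> Ob L" "b \<in> Sub L (B \<otimes> Y)"
      "f \<in> Ar L" "Dom L f = A" "Cod L f = B" "F \<in> Ar L" "Dom L F = A \<otimes> Y" "Cod L F = X"
    using that sub_le_pullback_iff[OF has_pullbacks, of a "\<langle>pr1 L A Y, F\<rangle>" b "f \<times>\<^bsub>L\<^esub> Id L Y"]
    by (auto simp: prod_map_Id)
  then show ?thesis
    by (auto simp: Dial_def Hom_iff)
qed

lemma Dial_HomE:
  assumes "\<phi> \<in> Hom (Dial L) S T"
  obtains A X a B Y b f F where
    "S = (A, X, a)" "T = (B, Y, b)" "\<phi> = ((A, X, a), (B, Y, b), f, F)"
    "A \<in> Ob L" "X \<in> Ob L" "a \<in> Sub L (A \<otimes> X)" "B \<in> Ob L" "Y \<in> Ob L" "b \<in> Sub L (B \<otimes> Y)"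
    "f \<in> Hom L A B" "F \<in> Hom L (A \<otimes> Y) X"
    "\<And>t. t \<in> Ar L \<Longrightarrow> Cod L t = A \<otimes> Y \<Longrightarrow> in_sub L (t \<Zcomp> \<langle>pr1 L A Y, F\<rangle>) a
       \<Longrightarrow> in_sub L (t \<Zcomp> (f \<times>\<^bsub>L\<^esub> Id L Y)) b"
proof -
  obtain A X a B Y b f F where \<phi>: "\<phi> = ((A, X, a), (B, Y, b), f, F)"
    by (metis surj_pair)
  with assms show ?thesis
    by (intro that[of A X a B Y b f F])
      (simp_all add: Hom_iff Dial_Ar_iff Dial_simps)
qed

text \<open>A generalized element \<open>s\<close> over \<open>A \<times> Z\<close> is transported in two stages: first to
  \<open>s \<Zcomp> \<langle>\<pi>\<^sub>1, (f \<times> 1) \<Zcomp> G\<rangle>\<close> over \<open>A \<times> Y\<close>, where \<open>(f, F)\<close> applies, and then to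
  \<open>s \<Zcomp> (f \<times> 1)\<close> over \<open>B \<times> Z\<close>, where \<open>(g, G)\<close> applies. Both stages meet in
  \<open>s \<Zcomp> \<langle>\<pi>\<^sub>1 \<Zcomp> f, (f \<times> 1) \<Zcomp> G\<rangle>\<close>.\<close>

lemma Dial_Comp_Ar:
  assumes \<phi>: "((A, X, a), (B, Y, b), f, F) \<in> Ar (Dial L)"
    and \<psi>: "((B, Y, b), (C, Z, c), g, G) \<in> Ar (Dial L)"
  shows "((A, X, a), (C, Z, c), f \<Zcomp> g, \<langle>pr1 L A Z, (f \<times>\<^bsub>L\<^esub> Id L Z) \<Zcomp> G\<rangle> \<Zcomp> F) \<in> Ar (Dial L)"
proof -
  let ?k = "\<langle>pr1 L A Z, (f \<times>\<^bsub>L\<^esub> Id L Z) \<Zcomp> G\<rangle>"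
  have ob: "A \<in> Ob L" "X \<in> Ob L" "B \<in> Ob L" "Y \<in> Ob L" "C \<in> Ob L" "Z \<in> Ob L"
    and f: "f \<in> Ar L" "Dom L f = A" "Cod L f = B"
    and F: "F \<in> Ar L" "Dom L F = A \<otimes> Y" "Cod L F = X"
    and g: "g \<in> Ar L" "Dom L g = B" "Cod L g = C"
    and G: "G \<in> Ar L" "Dom L G = B \<otimes> Z" "Cod L G = Y"
    using \<phi> \<psi> by (auto simp: Dial_Ar_iff)
  have \<phi>_le: "in_sub L (t \<Zcomp> (f \<times>\<^bsub>L\<^esub> Id L Y)) b"
    if "t \<in> Ar L" "Cod L t = A \<otimes> Y" "in_sub L (t \<Zcomp> \<langle>pr1 L A Y, F\<rangle>) a" for t
    using \<phi> that unfolding Dial_Ar_iff by blast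
  have \<psi>_le: "in_sub L (t \<Zcomp> (g \<times>\<^bsub>L\<^esub> Id L Z)) c"
    if "t \<in> Ar L" "Cod L t = B \<otimes> Z" "in_sub L (t \<Zcomp> \<langle>pr1 L B Z, G\<rangle>) b" for t
    using \<psi> that unfolding Dial_Ar_iff by blast
  note ty = ob f F g G prod_map_Id
  have "in_sub L (s \<Zcomp> ((f \<Zcomp> g) \<times>\<^bsub>L\<^esub> Id L Z)) c"
    if s: "s \<in> Ar L" "Cod L s = A \<otimes> Z" "in_sub L (s \<Zcomp> \<langle>pr1 L A Z, ?k \<Zcomp> F\<rangle>) a" for s
  proof -
    have "in_sub L ((s \<Zcomp> ?k) \<Zcomp> \<langle>pr1 L A Y, F\<rangle>) a"
      using s by (simp add: ty)
    then have "in_sub L ((s \<Zcomp> ?k) \<Zcomp> (f \<times>\<^bsub>L\<^esub> Id L Y)) b"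
      by (rule \<phi>_le[rotated 2]) (use s in \<open>simp_all add: ty\<close>)
    also have "(s \<Zcomp> ?k) \<Zcomp> (f \<times>\<^bsub>L\<^esub> Id L Y) = (s \<Zcomp> (f \<times>\<^bsub>L\<^esub> Id L Z)) \<Zcomp> \<langle>pr1 L B Z, G\<rangle>"
      using s by (simp add: ty)
    finally have "in_sub L ((s \<Zcomp> (f \<times>\<^bsub>L\<^esub> Id L Z)) \<Zcomp> (g \<times>\<^bsub>L\<^esub> Id L Z)) c"
      by (rule \<psi>_le[rotated 2]) (use s in \<open>simp_all add: ty\<close>)
    then show ?thesis
      using s by (simp add: ty)
  qed
  moreover have "a \<in> Sub L (A \<otimes> X)" "c \<in> Sub L (C \<otimes> Z)"
    using \<phi> \<psi> by (simp_all add: Dial_Ar_iff)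
  moreover have "?k \<Zcomp> F \<in> Hom L (A \<otimes> Z) X"
    by (simp add: ty Hom_iff)
  ultimately show ?thesis
    using ob f g unfolding Dial_Ar_iff by (simp add: Hom_iff)
qed

lemma category_Dial: "category (Dial L)"
proof
  fix \<phi> assume "\<phi> \<in> Ar (Dial L)"
  then have "\<phi> \<in> Hom (Dial L) (Dom (Dial L) \<phi>) (Cod (Dial L) \<phi>)"
    by (simp add: Hom_iff)
  then show "Dom (Dial L) \<phi> \<in> Ob (Dial L)" "Cod (Dial L) \<phi> \<in> Ob (Dial L)"
    by (elim Dial_HomE, simp add: Dial_simps)+
next
  fix S assume "S \<in> Ob (Dial L)"
  then show "Id (Dial L) S \<in> Hom (Dial L) S S"
    by (auto simp: Dial_simps Dial_Ar_iff Hom_iff prod_map_Id)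
next
  fix \<phi> \<psi> S T U
  assume "\<phi> \<in> Hom (Dial L) S T" "\<psi> \<in> Hom (Dial L) T U"
  then show "\<phi> \<Zcomp>\<^bsub>Dial L\<^esub> \<psi> \<in> Hom (Dial L) S U"
    using Dial_Comp_Ar
    by (cases \<phi>; cases \<psi>; cases S; cases T; cases U) (auto simp: Dial_simps Hom_iff)
next
  fix \<phi> S T
  assume "\<phi> \<in> Hom (Dial L) S T"
  then show "Id (Dial L) S \<Zcomp>\<^bsub>Dial L\<^esub> \<phi> = \<phi>" "\<phi> \<Zcomp>\<^bsub>Dial L\<^esub> Id (Dial L) T = \<phi>"
    by (elim Dial_HomE, clarify, simp add: Dial_simps prod_map_Id Hom_iff)+
next
  fix \<phi> \<psi> \<chi> S T U V
  assume "\<phi> \<in> Hom (Dial L) S T" "\<psi> \<in> Hom (Dial L) T U" "\<chi> \<in> Hom (Dial L) U V"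
  then show "(\<phi> \<Zcomp>\<^bsub>Dial L\<^esub> \<psi>) \<Zcomp>\<^bsub>Dial L\<^esub> \<chi> = \<phi> \<Zcomp>\<^bsub>Dial L\<^esub> (\<psi> \<Zcomp>\<^bsub>Dial L\<^esub> \<chi>)"
    by (elim Dial_HomE, clarify, simp add: Dial_simps prod_map_Id Hom_iff)
qed

text \<open>All arrows are generalized elements of the total subobject, which makes the implication
  in the definition of an arrow vacuous.\<close>

lemma Dial_Ar_top_iff:
  assumes "A \<in> Ob L" "X \<in> Ob L" "B \<in> Ob L" "Y \<in> Ob L"
  shows "((A, X, sub_top L (A \<otimes> X)), (B, Y, sub_top L (B \<otimes> Y)), f, F) \<in> Ar (Dial L) \<longleftrightarrow>
    f \<in> Hom L A B \<and> F \<in> Hom L (A \<otimes> Y) X"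
  using assms
  by (auto simp: Dial_Ar_iff Hom_iff sub_top_Sub prod_map_Id intro!: in_sub_top)

section \<open>The isomorphism\<close>

lemma EDial_Ob: "Ob (EDial L) = {(A, X, sub_top L (A \<otimes> X)) | A X. A \<in> Ob L \<and> X \<in> Ob L}"
  by (simp add: EDial_def)

lemma EDial_Ob_subset: "Ob (EDial L) \<subseteq> Ob (Dial L)"
  by (auto simp: EDial_Ob Dial_simps sub_top_Sub)

lemma EDial_ArE:
  assumes "\<phi> \<in> Ar (EDial L)"
  obtains A X B Y f F where
    "\<phi> = ((A, X, sub_top L (A \<otimes> X)), (B, Y, sub_top L (B \<otimes> Y)), f, F)"
    "A \<in> Ob L" "X \<in> Ob L" "B \<in> Ob L" "Y \<in> Ob L"
    "f \<in> Hom L A B" "F \<in> Hom L (A \<otimes> Y) X"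
  using assms Dial_Ar_top_iff
  by (cases \<phi>) (auto simp: EDial_def Dial_simps Hom_iff)

lemma lens_to_dial_simps:
  "onOb (lens_to_dial L) (A, X, p) = (A, X, sub_top L (A \<otimes> X))"
  "onAr (lens_to_dial L) ((A, X, p), (B, Y, q), f, (F, r)) =
     ((A, X, sub_top L (A \<otimes> X)), (B, Y, sub_top L (B \<otimes> Y)), f, F \<Zcomp> pr2 L A X)"
  by (simp_all add: lens_to_dial_def lens_to_dial_ob_def)

lemma dial_to_lens_simps:
  "onOb (dial_to_lens L) (A, X, a) = (A, X, pr1 L A X)"
  "onAr (dial_to_lens L) ((A, X, a), (B, Y, b), f, F) =
     ((A, X, pr1 L A X), (B, Y, pr1 L B Y), f, (\<langle>pr1 L A Y, F\<rangle>, f \<times>\<^bsub>L\<^esub> Id L Y))"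
  by (simp_all add: dial_to_lens_def dial_to_lens_ob_def)

lemma is_functor_lens_to_dial: "is_functor (ELens L) (Dial L) (lens_to_dial L)"
  unfolding is_functor_def
proof (intro conjI ballI impI category_ELens category_Dial)
  fix S assume "S \<in> Ob (ELens L)"
  then show "onOb (lens_to_dial L) S \<in> Ob (Dial L)"
    by (auto simp: ELens_simps Dial_simps lens_to_dial_simps sub_top_Sub)
  from \<open>S \<in> Ob (ELens L)\<close>
  show "onAr (lens_to_dial L) (Id (ELens L) S) = Id (Dial L) (onOb (lens_to_dial L) S)"
    by (auto simp: ELens_simps Dial_simps lens_to_dial_simps)
next
  fix \<phi> assume "\<phi> \<in> Ar (ELens L)"
  then show "onAr (lens_to_dial L) \<phi> \<in>
      Hom (Dial L) (onOb (lens_to_dial L) (Dom (ELens L) \<phi>)) (onOb (lens_to_dial L) (Cod (ELens L) \<phi>))"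
    by (elim ELens_ArE)
      (simp add: ELens_simps lens_to_dial_simps Hom_iff Dial_simps Dial_Ar_top_iff)
next
  fix \<phi> \<psi> assume "\<phi> \<in> Ar (ELens L)" "\<psi> \<in> Ar (ELens L)" "Cod (ELens L) \<phi> = Dom (ELens L) \<psi>"
  then show "onAr (lens_to_dial L) (\<phi> \<Zcomp>\<^bsub>ELens L\<^esub> \<psi>) =
      onAr (lens_to_dial L) \<phi> \<Zcomp>\<^bsub>Dial L\<^esub> onAr (lens_to_dial L) \<psi>"
    by (elim ELens_ArE, clarsimp simp: ELens_simps)
      (simp add: lens_to_dial_simps Dial_simps prod_map_Id Hom_iff)
qed

lemma inverse_lens_to_dial_dial_to_lens:
  "inverse_functors (ELens L) (EDial L) (lens_to_dial L) (dial_to_lens L)"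
proof (rule inverse_functorsI)
  have "onOb (lens_to_dial L) ` Ob (ELens L) \<subseteq> Ob (EDial L)"
    by (auto simp: ELens_simps EDial_Ob lens_to_dial_simps)
  then show "is_functor (ELens L) (EDial L) (lens_to_dial L)"
    using is_functor_full_subcat[OF is_functor_lens_to_dial EDial_Ob_subset]
    by (simp add: EDial_def)
next
  fix \<phi> assume "\<phi> \<in> Ar (ELens L)"
  \<comment> \<open>The left leg \<open>F\<close> is recovered as \<open>\<langle>F \<Zcomp> \<pi>\<^sub>1, F \<Zcomp> \<pi>\<^sub>2\<rangle>\<close>, as \<open>F \<Zcomp> \<pi>\<^sub>1\<close> is prescribed.\<close>
  then show "onAr (dial_to_lens L) (onAr (lens_to_dial L) \<phi>) = \<phi>"
  proof (cases rule: ELens_ArE)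
    case (1 A X B Y f F)
    then show ?thesis
      using pairing_Comp_pr1_pr2[of F A X]
      by (simp add: lens_to_dial_simps dial_to_lens_simps Hom_iff)
  qed
next
  fix \<phi> assume "\<phi> \<in> Ar (EDial L)"
  then show "onAr (dial_to_lens L) \<phi> \<in> Ar (ELens L)"
    and "onAr (lens_to_dial L) (onAr (dial_to_lens L) \<phi>) = \<phi>"
    by (elim EDial_ArE, simp add: lens_to_dial_simps dial_to_lens_simps ELens_Ar_iff Hom_iff)+
qed (auto simp: ELens_simps EDial_Ob lens_to_dial_simps dial_to_lens_simps)

text \<open>The image is the target of the isomorphism because its inverse exhibits every object and
  arrow of that target as a value.\<close>

lemma image_lens_to_dial: "image_cat (ELens L) (Dial L) (lens_to_dial L) = EDial L"
proof -
  note inv = inverse_lens_to_dial_dial_to_lens[unfolded inverse_functors_def is_functor_def]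
  have "onOb (lens_to_dial L) ` Ob (ELens L) = Ob (EDial L)"
    using inv by (auto simp: image_iff) metis
  moreover have "onAr (lens_to_dial L) ` Ar (ELens L) = Ar (EDial L)"
    using inv by (auto simp: image_iff Hom_iff) metis
  ultimately show ?thesis
    by (simp add: image_cat_def EDial_def full_subcat_def)
qed

lemma Hom_EDial:
  assumes "A \<in> Ob L" "X \<in> Ob L" "B \<in> Ob L" "Y \<in> Ob L"
  shows "Hom (EDial L) (A, X, sub_top L (A \<otimes> X)) (B, Y, sub_top L (B \<otimes> Y)) =
    {((A, X, sub_top L (A \<otimes> X)), (B, Y, sub_top L (B \<otimes> Y)), f, F) | f F.
       f \<in> Hom L A B \<and> F \<in> Hom L (A \<otimes> Y) X}"
  using assms
  by (auto simp: EDial_def Hom_full_subcat Hom_iff[of _ "Dial L"] Dial_simps Dial_Ar_top_iff)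

end

theorem proposition4p4:
  fixes L :: "('o, 'm, 'z) prod_cat_scheme"
  assumes "category L" and "has_pullbacks L" and "has_binary_products L"
  shows "is_functor (ELens L) (Dial L) (lens_to_dial L)
    \<and> image_cat (ELens L) (Dial L) (lens_to_dial L) = EDial L
    \<and> (\<forall>A \<in> Ob L. \<forall>X \<in> Ob L. \<forall>B \<in> Ob L. \<forall>Y \<in> Ob L.
         Hom (EDial L) (A, X, sub_top L (A \<otimes>\<^bsub>L\<^esub> X)) (B, Y, sub_top L (B \<otimes>\<^bsub>L\<^esub> Y)) =
           {((A, X, sub_top L (A \<otimes>\<^bsub>L\<^esub> X)), (B, Y, sub_top L (B \<otimes>\<^bsub>L\<^esub> Y)), f, F) | f F.
              f \<in> Hom L A B \<and> F \<in> Hom L (A \<otimes>\<^bsub>L\<^esub> Y) X})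
    \<and> cat_isomorphism (ELens L) (EDial L) (lens_to_dial L)
    \<and> inverse_functors (ELens L) (EDial L) (lens_to_dial L) (dial_to_lens L)"
proof -
  interpret product_pullback_category L
    using assms by (simp add: product_pullback_category_def product_category_def
        product_category_axioms_def product_pullback_category_axioms_def)
  show ?thesis
    using is_functor_lens_to_dial image_lens_to_dial Hom_EDial inverse_lens_to_dial_dial_to_lens
    by (auto simp: cat_isomorphism_def)
qed

end
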